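(* Let $q\in\{0\}\cup\{2,3,4,\dots\}$. Suppose the potential $V:\mathbb{N}\to\mathbb{R}$ satisfies $$\limsup_{n\to\infty}|nV(n)|=a<\frac{1}{A_q},$$ and let $E_q=2\sqrt{1-a^2A_q^2}$. Then for any boundary condition $\frac{u(1)}{u(0)}=\tan\theta$, the operator $H=H_0+V$ on the half line does not admit any eigenvalue in $(-E_q,E_q)\cap S_q$.
   Context: Here $\mathbb{N}=\{1,2,\dots\}$. The half-line discrete Schrödinger operator $H=H_0+V$ with boundary condition $\theta\in[0,\pi]$ is given by $(Hu)(n)=u(n+1)+u(n-1)+V(n)u(n)$ for $n\ge 1$, with $\frac{u(1)}{u(0)}=\tan\theta$ (i.e. $u(1)\cos\theta=u(0)\sin\theta$). A number $E$ is an eigenvalue if there is a nontrivial solution $u$ of $u(n+1)+u(n-1)+V(n)u(n)=Eu(n)$ ($n\ge1$) satisfying the boundary condition with $u\in\ell^2(\mathbb{N})$. For $E\in(-2,2)$, $k(E)\in(0,1)$ is defined by $E=2\cos\pi k(E)$. For an integer $q\ge2$, $S_q=\{E\in(-2,2): k(E)=p/q \text{ for some } p\in\{1,\dots,q-1\} \text{ with } \gcd(p,q)=1\}$, and $S_0=\{E\in(-2,2): k(E)\text{ is irrational}\}$. The constants are: $A_0=\frac{2}{\pi}$; for even $q\ge2$, $A_q=\frac{2}{q\sin(\pi/q)}$; for odd $q\ge3$, $A_q=\frac{2\cos(\pi/(2q))}{q\sin(\pi/q)}$. *)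

theory Defs
  imports "HOL-Analysis.Analysis"
begin

(* (H u)(n) for the half-line operator H = H_0 + V.  The half line is {1, 2, ...}: only the values
   at n \<ge> 1 are meaningful, V 0 is never used, and u 0 is the boundary value. *)
definition schroedinger :: "(nat \<Rightarrow> real) \<Rightarrow> (nat \<Rightarrow> complex) \<Rightarrow> nat \<Rightarrow> complex" where
  "schroedinger V u n = u (n + 1) + u (n - 1) + of_real (V n) * u n"

(* u(1)/u(0) = tan \<theta>, written without division so that u(0) = 0 is allowed
   (\<theta> = pi/2, where tan is infinite). *)
definition boundary_condition :: "real \<Rightarrow> (nat \<Rightarrow> complex) \<Rightarrow> bool" where
  "boundary_condition \<theta> u \<longleftrightarrow> u 1 * of_real (cos \<theta>) = u 0 * of_real (sin \<theta>)"

definition is_eigenvalue :: "(nat \<Rightarrow> real) \<Rightarrow> real \<Rightarrow> real \<Rightarrow> bool" where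
  "is_eigenvalue V \<theta> E \<longleftrightarrow>
     (\<exists>u. (\<exists>n. u n \<noteq> 0) \<and>
          (\<forall>n\<ge>1. schroedinger V u n = of_real E * u n) \<and>
          boundary_condition \<theta> u \<and>
          (\<lambda>n. (cmod (u n))\<^sup>2) summable_on {1..})"

definition quasimomentum :: "real \<Rightarrow> real" where
  "quasimomentum E = (THE k. 0 < k \<and> k < 1 \<and> E = 2 * cos (pi * k))"

(* The index 0 stands for irrational quasimomentum. *)
definition S :: "nat \<Rightarrow> real set" where
  "S q = (if q = 0
          then {E \<in> {-2<..<2}. quasimomentum E \<notin> \<rat>}
          else {E \<in> {-2<..<2}. \<exists>p\<in>{1..q - 1}. coprime p q \<and> quasimomentum E = real p / real q})"

(* The value at q = 1 is a dummy (0, by x / 0 = 0); the constants are used only for q \<noteq> 1. *)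
definition A :: "nat \<Rightarrow> real" where
  "A q = (if q = 0 then 2 / pi
          else if even q then 2 / (real q * sin (pi / real q))
          else 2 * cos (pi / (2 * real q)) / (real q * sin (pi / real q)))"

end

theory Submission
  imports Defs "HOL-Real_Asymp.Real_Asymp"
begin

text \<open>
  The mechanism is a quantitative Pruefer argument. Let \<open>E = 2 cos (pi k)\<close> with \<open>0 < k < 1\<close> and put
  \<open>s = sin (pi k) > 0\<close>. For a real solution \<open>v\<close> the complex numbers
  \<open>y n = e\<^sup>i\<^sup>\<pi>\<^sup>k v n - v (n - 1)\<close> satisfy
  \<open>y (n + 1) = e\<^sup>i\<^sup>\<pi>\<^sup>k (y n - (V n / s) Im (y n))\<close>: a rotation by the angle \<open>pi k\<close>, perturbed by
  a relative error of size \<open>O(1/n)\<close>. If \<open>v\<close> is square summable, so is \<open>y\<close>; the claim is that \<open>y\<close>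
  decays too slowly for that.

  Let \<open>\<zeta> n\<close> be the square of the unit vector \<open>y n / |y n|\<close>. Expanding the square of the modulus gives
  \<open>|y (n + 1)|\<^sup>2 \<ge> |y n|\<^sup>2 (1 - (c / n) |Im (\<zeta> n)|)\<close> whenever \<open>|V n| / s \<le> c / n\<close>. Up to \<open>O(1/n)\<close>,
  the \<open>\<zeta>\<close> of a block of fixed length \<open>L\<close> are the points of an orbit of the rotation by \<open>2 pi k\<close>, so
  the relative loss of \<open>|y|\<^sup>2\<close> over a block starting at \<open>n\<close> is at most
  \<open>(c / n) max\<^sub>x (\<Sum>j<L. |sin (x + 2 pi j k)|)\<close> to leading order. The constant \<open>A q\<close> is exactly the
  mean value of this maximal sum: for \<open>k = p / q\<close> and \<open>L = q\<close> the sum is at most \<open>q (A q)\<close>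
  (\<open>sum_abs_sin_rational_rotation_le\<close>), and for irrational \<open>k\<close> the sum is at most \<open>L (2 / pi + \<epsilon>)\<close>
  for a suitable \<open>L\<close> (\<open>sum_abs_sin_irrational_rotation_le\<close>). The latter follows from the rational case:
  \<open>k\<close> has approximations \<open>p / q\<close> with error below \<open>1 / q\<^sup>2\<close>, and \<open>A q\<close> tends to \<open>2 / pi\<close>.

  The energy bound \<open>|E| < E_q\<close> says precisely that \<open>a A\<^sub>q < s\<close>, so \<open>c\<close> can be chosen with
  \<open>c (A q + \<epsilon>) < 1\<close>. Then \<open>|y (n + L)|\<^sup>2 \<ge> (1 - L / n) |y n|\<^sup>2\<close> for large \<open>n\<close>, which means that
  \<open>(m - 1) |y (m L)|\<^sup>2\<close> is eventually nondecreasing in \<open>m\<close>. So \<open>|y|\<^sup>2\<close> dominates a harmonic series along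
  the multiples of \<open>L\<close> and is not summable (\<open>perturbed_rotation_not_summable\<close>).
\<close>

section \<open>Sums of absolute sines over finite rotations\<close>

lemma abs_sin_plus_of_int_pi: "\<bar>sin (x + of_int n * pi)\<bar> = \<bar>sin x\<bar>"
proof -
  have "sin (of_int n * pi) = 0" by (metis sin_zero_iff_int2)
  moreover have "\<bar>cos (of_int n * pi)\<bar> = 1"
    using sin_zero_abs_cos_one[OF calculation] by simp
  ultimately show ?thesis by (simp add: sin_add abs_mult)
qed

text \<open>
  Since \<open>|sin|\<close> has period \<open>pi\<close>, only the residue of \<open>j c\<close> modulo \<open>m\<close> matters, and multiplication by
  the unit \<open>c\<close> permutes these residues.
\<close>

lemma sum_abs_sin_multiples:
  assumes m: "0 < m" and c: "coprime c (int m)"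
  shows "(\<Sum>j<m. \<bar>sin (x + pi * (of_nat j * of_int c) / of_nat m)\<bar>)
       = (\<Sum>r<m. \<bar>sin (x + pi * of_nat r / of_nat m)\<bar>)"
proof -
  define \<phi> where "\<phi> j = nat (int j * c mod int m)" for j
  have inj: "inj_on \<phi> {..<m}"
  proof (rule inj_onI)
    fix i j assume ij: "i \<in> {..<m}" "j \<in> {..<m}" "\<phi> i = \<phi> j"
    then have "int i * c mod int m = int j * c mod int m"
      using m by (simp add: \<phi>_def eq_nat_nat_iff)
    then have "int m dvd (int i - int j) * c"
      by (simp add: mod_eq_dvd_iff left_diff_distrib)
    then have "int i mod int m = int j mod int m"
      using c by (simp add: coprime_dvd_mult_left_iff coprime_commute mod_eq_dvd_iff)
    with ij show "i = j" by simp
  qed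
  have "\<phi> ` {..<m} \<subseteq> {..<m}"
    using m by (auto simp: \<phi>_def nat_less_iff pos_mod_bound)
  then have bij: "bij_betw \<phi> {..<m} {..<m}"
    using endo_inj_surj[OF _ _ inj] inj by (simp add: bij_betw_def)
  have red: "\<bar>sin (x + pi * (of_nat j * of_int c) / of_nat m)\<bar> = \<bar>sin (x + pi * of_nat (\<phi> j) / of_nat m)\<bar>" for j
  proof -
    define d where "d = int j * c div int m"
    have "int j * c = int (\<phi> j) + int m * d"
      using m by (simp add: \<phi>_def d_def)
    from arg_cong[OF this, of real_of_int]
    have "of_nat j * real_of_int c = of_nat (\<phi> j) + of_nat m * of_int d"
      by simp
    then have "x + pi * (of_nat j * of_int c) / of_nat m = (x + pi * of_nat (\<phi> j) / of_nat m) + of_int d * pi"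
      using m by (simp add: field_simps)
    then show ?thesis
      by (simp only: abs_sin_plus_of_int_pi)
  qed
  have "(\<Sum>j<m. \<bar>sin (x + pi * (of_nat j * of_int c) / of_nat m)\<bar>)
      = (\<Sum>j<m. \<bar>sin (x + pi * of_nat (\<phi> j) / of_nat m)\<bar>)"
    using red by simp
  also have "\<dots> = (\<Sum>r<m. \<bar>sin (x + pi * of_nat r / of_nat m)\<bar>)"
    by (rule sum.reindex_bij_betw[OF bij])
  finally show ?thesis .
qed

text \<open>
  The \<open>m\<close> points are equidistributed modulo the period \<open>pi\<close>, so a shift by a multiple of the spacing
  only permutes them. This allows the base point to be moved into \<open>[0, pi / m)\<close>, where all the sines
  are nonnegative and the sum telescopes.
\<close>

lemma sum_abs_sin_equispaced_shift:
  assumes m: "0 < m"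
  shows "(\<Sum>r<m. \<bar>sin (x + pi * of_int n / of_nat m + pi * of_nat r / of_nat m)\<bar>)
       = (\<Sum>r<m. \<bar>sin (x + pi * of_nat r / of_nat m)\<bar>)"
proof -
  define f where "f i = \<bar>sin (x + pi * of_int i / of_nat m)\<bar>" for i :: int
  have per: "f (i + int m) = f i" for i
  proof -
    have "x + pi * of_int (i + int m) / of_nat m = (x + pi * of_int i / of_nat m) + of_int 1 * pi"
      using m by (simp add: field_simps)
    then show ?thesis unfolding f_def by (simp only: abs_sin_plus_of_int_pi)
  qed
  \<comment> \<open>A shift by one index drops the term \<open>f i\<close> and gains the equal term \<open>f (i + m)\<close>.\<close>
  have one: "(\<Sum>r<m. f (i + 1 + int r)) = (\<Sum>r<m. f (i + int r))" for i
    using sum.lessThan_Suc_shift[of "\<lambda>r. f (i + int r)" m] per[of i]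
    by (simp add: add_ac)
  have "(\<Sum>r<m. f (n + int r)) = (\<Sum>r<m. f (0 + int r))"
  proof (induction n rule: int_induct[of _ 0])
    case base show ?case by simp
  next
    case (step1 i) then show ?case using one[of i] by simp
  next
    case (step2 i) then show ?case using one[of "i - 1"] by simp
  qed
  then show ?thesis
    by (simp add: f_def distrib_left add_divide_distrib add_ac)
qed

text \<open>
  Multiplied by \<open>2 sin (pi / (2 m))\<close> the sum telescopes to \<open>2 cos (x0 - pi / (2 m))\<close>, where \<open>x0\<close> is the
  reduced base point. The bound is attained at \<open>x0 = pi / (2 m)\<close>, which is why no better constant than
  \<open>A q\<close> can come out of this method.
\<close>

lemma sum_abs_sin_equispaced_le:
  assumes m: "0 < m"
  shows "(\<Sum>r<m. \<bar>sin (x + pi * of_nat r / of_nat m)\<bar>) \<le> 1 / sin (pi / (2 * of_nat m))"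
proof -
  define h where "h = pi / (2 * of_nat m)"
  have h: "0 < sin h"
    using m by (intro sin_gt_zero) (auto simp: h_def field_simps)
  define n where "n = \<lfloor>x * of_nat m / pi\<rfloor>"
  define x0 where "x0 = x - pi * of_int n / of_nat m"
  have n: "of_int n \<le> x * of_nat m / pi" "x * of_nat m / pi < of_int n + 1"
    unfolding n_def by linarith+
  have x0: "0 \<le> x0" "x0 < pi / of_nat m"
  proof -
    have "x0 = (x * of_nat m / pi - of_int n) * (pi / of_nat m)"
      using m by (simp add: x0_def field_simps)
    moreover have "(x * of_nat m / pi - of_int n) * (pi / of_nat m) < 1 * (pi / of_nat m)"
      using n m by (intro mult_strict_right_mono) auto
    ultimately show "0 \<le> x0" "x0 < pi / of_nat m"
      using n by simp_all
  qed
  have nonneg: "0 \<le> sin (x0 + pi * of_nat r / of_nat m)" if "r < m" for r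
  proof (rule sin_ge_zero)
    show "0 \<le> x0 + pi * of_nat r / of_nat m" using x0 by simp
    have "x0 + pi * of_nat r / of_nat m \<le> pi * (of_nat r + 1) / of_nat m"
      using x0 by (simp add: distrib_left add_divide_distrib)
    also have "\<dots> \<le> pi"
    proof -
      have "pi * (real r + 1) \<le> pi * real m" using that by (intro mult_left_mono) auto
      then show ?thesis using m by (simp add: divide_le_eq)
    qed
    finally show "x0 + pi * of_nat r / of_nat m \<le> pi" .
  qed
  have mh: "2 * of_nat m * h = pi" using m by (simp add: h_def)
  have tele: "2 * sin h * sin (x0 + pi * of_nat r / of_nat m)
      = cos (x0 - h + 2 * of_nat r * h) - cos (x0 - h + 2 * of_nat (Suc r) * h)" for r
  proof -
    have "pi * of_nat r / of_nat m = 2 * of_nat r * h" using m by (simp add: h_def)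
    moreover have "x0 - h + 2 * of_nat r * h = (x0 + 2 * of_nat r * h) - h"
      "x0 - h + 2 * of_nat (Suc r) * h = (x0 + 2 * of_nat r * h) + h"
      by (simp_all add: algebra_simps)
    ultimately show ?thesis
      by (simp only: cos_diff[of "x0 + 2 * of_nat r * h" h] cos_add[of "x0 + 2 * of_nat r * h" h]) simp
  qed
  have "2 * sin h * (\<Sum>r<m. \<bar>sin (x0 + pi * of_nat r / of_nat m)\<bar>)
      = (\<Sum>r<m. cos (x0 - h + 2 * of_nat r * h) - cos (x0 - h + 2 * of_nat (Suc r) * h))"
    unfolding sum_distrib_left tele[symmetric] using nonneg by simp
  also have "\<dots> = cos (x0 - h) - cos (x0 - h + pi)"
    by (subst sum_lessThan_telescope') (simp add: mh)
  also have "\<dots> \<le> 2" by (simp add: cos_add)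
  finally have "(\<Sum>r<m. \<bar>sin (x0 + pi * of_nat r / of_nat m)\<bar>) \<le> 1 / sin h"
    using h by (simp add: field_simps)
  then show ?thesis
    using sum_abs_sin_equispaced_shift[OF m, of x0 n] by (simp add: x0_def h_def)
qed

text \<open>
  Both forms of \<open>A q\<close> have one source. The orbit of length \<open>q\<close> has \<open>m\<close> distinct points modulo \<open>pi\<close>,
  with \<open>m = q / 2\<close> and each point hit twice for even \<open>q\<close>, and \<open>m = q\<close> for odd \<open>q\<close>; the maximal sum
  of \<open>|sin|\<close> over \<open>m\<close> equispaced points is \<open>1 / sin (pi / (2 m))\<close>.
\<close>

lemma A_even: "even q \<Longrightarrow> q \<noteq> 0 \<Longrightarrow> real q * A q = 2 / sin (pi / real q)"
  by (auto simp: A_def)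

lemma A_odd: 
  assumes "odd q" and q: "q \<ge> 2" 
  shows "real q * A q = 1 / sin (pi / (2 * real q))"
proof -
  define h where "h = pi / (2 * real q)"
  have "sin (pi / real q) = 2 * sin h * cos h"
    using sin_double[of h] q by (simp add: h_def field_simps)
  moreover have "cos h > 0"
    using q by (intro cos_gt_zero) (auto simp: h_def field_simps)
  ultimately show ?thesis
    using assms by (simp add: A_def h_def)
qed

lemma A_pos:
  assumes "q = 0 \<or> q \<ge> 2" shows "A q > 0"
proof (cases "q = 0")
  case False
  with assms have q: "q \<ge> 2" by simp
  have "0 < sin (pi / real q)" using q by (intro sin_gt_zero) (auto simp: field_simps)
  moreover have "0 < cos (pi / (2 * real q))" using q by (intro cos_gt_zero) (auto simp: field_simps)
  ultimately show ?thesis using q by (auto simp: A_def)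
qed (simp add: A_def)

lemma sum_lessThan_add:
  "(\<Sum>i<m + n. f i) = (\<Sum>i<m. f i) + (\<Sum>i<n. f (m + i))" for m n :: nat and f :: "nat \<Rightarrow> real"
  by (induction n) (simp_all add: add.assoc)

text \<open>
  Modulo \<open>pi\<close>, the angles \<open>2 pi j p / q\<close> are the multiples of \<open>pi / q\<close> if \<open>q\<close> is odd, because then
  \<open>2 p\<close> is a unit modulo \<open>q\<close>; if \<open>q = 2 m\<close>, they run twice through the multiples of \<open>pi / m\<close>.
\<close>

lemma sum_abs_sin_rational_rotation_le:
  assumes q: "q \<ge> 2" and p: "coprime p (int q)"
  shows "(\<Sum>j<q. \<bar>sin (x + 2 * pi * of_nat j * (of_int p / of_nat q))\<bar>) \<le> real q * A q"
proof (cases "even q")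
  case True
  then obtain m where m: "q = 2 * m" by blast
  with q have m0: "m > 0" by simp
  have pm: "coprime p (int m)" using p m by simp
  let ?g = "\<lambda>j. \<bar>sin (x + pi * (of_nat j * of_int p) / of_nat m)\<bar>"
  have "?g (m + j) = ?g j" for j
  proof -
    have "x + pi * (of_nat (m + j) * of_int p) / of_nat m = (x + pi * (of_nat j * of_int p) / of_nat m) + of_int p * pi"
      using m0 by (simp add: field_simps)
    then show ?thesis by (simp only: abs_sin_plus_of_int_pi)
  qed
  then have "(\<Sum>j<q. ?g j) = 2 * (\<Sum>j<m. ?g j)"
    using sum_lessThan_add[of ?g m m] by (simp only: m mult_2)
  moreover have "(\<Sum>j<q. \<bar>sin (x + 2 * pi * of_nat j * (of_int p / of_nat q))\<bar>) = (\<Sum>j<q. ?g j)"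
    using m by (intro sum.cong) (auto simp: field_simps)
  ultimately show ?thesis
    using sum_abs_sin_equispaced_le[OF m0, of x] sum_abs_sin_multiples[OF m0 pm, of x] True q m A_even[of q]
    by simp
next
  case False
  have "coprime (2 * p) (int q)" using False p by simp
  moreover have "(\<Sum>j<q. \<bar>sin (x + 2 * pi * of_nat j * (of_int p / of_nat q))\<bar>)
     = (\<Sum>j<q. \<bar>sin (x + pi * (of_nat j * of_int (2 * p)) / of_nat q)\<bar>)"
    by (intro sum.cong) (auto simp: field_simps)
  ultimately show ?thesis
    using sum_abs_sin_equispaced_le[of q x] sum_abs_sin_multiples[of q "2 * p" x] False q
    by (simp add: A_odd)
qed

section \<open>Irrational rotations\<close>

lemma A_tendsto: "A \<longlonglongrightarrow> 2 / pi"
proof (rule tendsto_sandwich)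
  let ?lo = "\<lambda>q::nat. 2 * cos (pi / (2 * real q)) / (real q * sin (pi / real q))"
  let ?hi = "\<lambda>q::nat. 2 / (real q * sin (pi / real q))"
  have "2 * inverse pi = 2 / pi" by (simp add: divide_inverse)
  moreover have "?lo \<longlonglongrightarrow> 2 * inverse pi" "?hi \<longlonglongrightarrow> 2 * inverse pi" by real_asymp+
  ultimately show "?lo \<longlonglongrightarrow> 2 / pi" "?hi \<longlonglongrightarrow> 2 / pi" by simp_all
  have pos: "0 \<le> real q * sin (pi / real q)" if "q \<ge> 2" for q
    using that by (intro mult_nonneg_nonneg sin_ge_zero) (auto simp: field_simps)
  show "\<forall>\<^sub>F q in sequentially. ?lo q \<le> A q"
    using eventually_ge_at_top[of 2] by eventually_elim (auto simp: A_def intro!: divide_right_mono pos)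
  show "\<forall>\<^sub>F q in sequentially. A q \<le> ?hi q"
    using eventually_ge_at_top[of 2] by eventually_elim (auto simp: A_def intro!: divide_right_mono pos)
qed

lemma abs_sin_diff_le: "\<bar>sin x - sin y\<bar> \<le> \<bar>x - y\<bar>" for x y :: real
proof -
  have "\<bar>sin x - sin y\<bar> = 2 * \<bar>sin ((x - y) / 2)\<bar> * \<bar>cos ((x + y) / 2)\<bar>"
    by (simp add: sin_diff_sin abs_mult)
  also have "\<dots> \<le> 2 * \<bar>(x - y) / 2\<bar> * 1"
    by (intro mult_mono abs_sin_x_le_abs_x) auto
  finally show ?thesis by simp
qed

text \<open>
  Replacing \<open>k\<close> by an approximation \<open>p / q\<close> with \<open>|k - p / q| < 1 / q\<^sup>2\<close> moves each of the first \<open>q\<close>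
  angles by at most \<open>2 pi / q\<close>, hence the mean over a block of length \<open>q\<close> by at most \<open>2 pi / q\<close>. So
  the mean is at most \<open>A q + 2 pi / q\<close>, uniformly in the starting point, and irrationality provides
  arbitrarily large \<open>q\<close>.
\<close>

lemma sum_abs_sin_irrational_rotation_le:
  assumes k: "k \<notin> \<rat>" and \<epsilon>: "\<epsilon> > 0"
  shows "\<exists>L>0. \<forall>x. (\<Sum>j<L. \<bar>sin (x + 2 * pi * of_nat j * k)\<bar>) \<le> real L * (2 / pi + \<epsilon>)"
proof -
  have "(\<lambda>q. A q + 2 * pi / real q) \<longlonglongrightarrow> 2 / pi + 0"
    by (intro tendsto_add A_tendsto) real_asymp
  then have "\<forall>\<^sub>F q in sequentially. A q + 2 * pi / real q < 2 / pi + \<epsilon>"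
    by (rule order_tendstoD) (use \<epsilon> in simp)
  then obtain N where N: "\<And>q. q \<ge> N \<Longrightarrow> A q + 2 * pi / real q < 2 / pi + \<epsilon>"
    unfolding eventually_sequentially by blast
  obtain p q' where "(p, q') \<in> approx_set k" and big: "q' > int N + 2"
    using infinite_approx_set[of k "int N + 2"] rational_iff_finite_approx_set[of k] k by blast
  then have cop: "coprime p q'" and close: "\<bar>k - of_int p / of_int q'\<bar> < 1 / (of_int q')\<^sup>2"
    by (auto simp: approx_set_def)
  define q where "q = nat q'"
  have q': "q' = int q" and q: "q \<ge> 2" "q \<ge> N" using big by (auto simp: q_def)
  have "(\<Sum>j<q. \<bar>sin (x + 2 * pi * of_nat j * k)\<bar>) \<le> real q * (2 / pi + \<epsilon>)" for x
  proof -
    have "\<bar>sin (x + 2 * pi * of_nat j * k)\<bar>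
        \<le> \<bar>sin (x + 2 * pi * of_nat j * (of_int p / of_nat q))\<bar> + 2 * pi / real q" if "j < q" for j
    proof -
      have "\<bar>sin (x + 2 * pi * of_nat j * k) - sin (x + 2 * pi * of_nat j * (of_int p / of_nat q))\<bar>
          \<le> \<bar>2 * pi * of_nat j * (k - of_int p / of_nat q)\<bar>"
        by (rule order_trans[OF abs_sin_diff_le]) (simp add: algebra_simps)
      also have "\<dots> = 2 * pi * of_nat j * \<bar>k - of_int p / of_nat q\<bar>"
        by (simp add: abs_mult)
      also have "\<dots> \<le> 2 * pi * of_nat q * (1 / (of_nat q)\<^sup>2)"
        using close that by (intro mult_mono) (auto simp: q')
      also have "\<dots> = 2 * pi / real q" using q by (simp add: power2_eq_square)
      finally show ?thesis by linarith
    qed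
    then have "(\<Sum>j<q. \<bar>sin (x + 2 * pi * of_nat j * k)\<bar>)
       \<le> (\<Sum>j<q. \<bar>sin (x + 2 * pi * of_nat j * (of_int p / of_nat q))\<bar> + 2 * pi / real q)"
      by (intro sum_mono) auto
    also have "\<dots> \<le> real q * A q + real q * (2 * pi / real q)"
      using sum_abs_sin_rational_rotation_le[OF q(1), of p x] cop q' by (simp add: sum.distrib)
    also have "\<dots> = real q * (A q + 2 * pi / real q)" by (simp add: distrib_left)
    also have "\<dots> \<le> real q * (2 / pi + \<epsilon>)"
      using N[OF q(2)] by (intro mult_left_mono) auto
    finally show ?thesis .
  qed
  then show ?thesis using q by (intro exI[of _ q]) auto
qed

section \<open>Block means at an energy of the given class\<close>

lemma quasimomentum_properties:
  assumes "E \<in> {-2<..<2}"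
  shows "0 < quasimomentum E" "quasimomentum E < 1" "E = 2 * cos (pi * quasimomentum E)"
proof -
  have ex: "0 < arccos (E / 2) / pi \<and> arccos (E / 2) / pi < 1 \<and> E = 2 * cos (pi * (arccos (E / 2) / pi))"
    using assms arccos_lt_bounded[of "E / 2"] by auto
  have "k = arccos (E / 2) / pi" if "0 < k \<and> k < 1 \<and> E = 2 * cos (pi * k)" for k
    using that by (simp add: arccos_cos)
  with ex have "0 < quasimomentum E \<and> quasimomentum E < 1 \<and> E = 2 * cos (pi * quasimomentum E)"
    unfolding quasimomentum_def
    by (rule theI[where P = "\<lambda>k. 0 < k \<and> k < 1 \<and> E = 2 * cos (pi * k)"])
  then show "0 < quasimomentum E" "quasimomentum E < 1" "E = 2 * cos (pi * quasimomentum E)"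
    by auto
qed

lemma sum_abs_sin_rotation_le:
  assumes q: "q = 0 \<or> q \<ge> 2" and E: "E \<in> S q" and \<epsilon>: "\<epsilon> > 0"
  shows "\<exists>L>0. \<forall>x. (\<Sum>j<L. \<bar>sin (x + 2 * pi * of_nat j * quasimomentum E)\<bar>) \<le> real L * (A q + \<epsilon>)"
proof (cases "q = 0")
  case True
  then show ?thesis
    using sum_abs_sin_irrational_rotation_le[OF _ \<epsilon>] E by (simp add: S_def A_def)
next
  case False
  then obtain p where p: "coprime p q" "quasimomentum E = of_int (int p) / real q"
    using E by (auto simp: S_def)
  have "real q * A q \<le> real q * (A q + \<epsilon>)" using \<epsilon> by (intro mult_left_mono) auto
  then have "(\<Sum>j<q. \<bar>sin (x + 2 * pi * of_nat j * quasimomentum E)\<bar>) \<le> real q * (A q + \<epsilon>)" for x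
    using sum_abs_sin_rational_rotation_le[of q "int p" x] p(1) q False unfolding p(2)
    by (simp add: order.trans)
  then show ?thesis using False by blast
qed

section \<open>Slow decay of perturbed rotations\<close>

lemma norm_sgn_diff_le:
  fixes y d :: complex
  assumes y: "y \<noteq> 0" 
  shows "norm (sgn (y - d) - sgn y) \<le> 2 * norm d / norm y"
proof -
  define r where "r = norm (y - d)"
  have "of_real (norm y) * (sgn (y - d) - sgn y) = (of_real (norm y) - of_real r) * sgn (y - d) - d"
  proof -
    have "of_real (norm y) * sgn y = y" "of_real r * sgn (y - d) = y - d"
      using y by (auto simp: r_def sgn_eq)
    then show ?thesis by (simp add: algebra_simps)
  qed
  then have "norm y * norm (sgn (y - d) - sgn y) = norm ((of_real (norm y) - of_real r) * sgn (y - d) - d)"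
    by (metis norm_mult norm_of_real abs_norm_cancel)
  also have "\<dots> \<le> norm ((of_real (norm y) - of_real r) * sgn (y - d)) + norm d"
    by (rule norm_triangle_ineq4)
  also have "norm ((of_real (norm y) - of_real r) * sgn (y - d)) \<le> norm d * 1"
    unfolding norm_mult
  proof (intro mult_mono)
    show "cmod (of_real (norm y) - of_real r) \<le> norm d"
      using norm_triangle_ineq3[of y "y - d"] unfolding r_def of_real_diff[symmetric] norm_of_real by simp
  qed (auto simp: norm_sgn)
  finally show ?thesis using y by (simp add: field_simps)
qed

text \<open>
  Iterating the steps gives the product of the factors \<open>1 - x i\<close>, which by the Weierstrass product
  inequality is at least one minus the sum of the \<open>x i\<close>.
\<close>

lemma one_minus_sum_lower_bound:
  fixes R x :: "nat \<Rightarrow> real"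
  assumes step: "\<And>j. j < L \<Longrightarrow> R (Suc j) \<ge> (1 - x j) * R j"
    and x: "\<And>j. j < L \<Longrightarrow> 0 \<le> x j" "\<And>j. j < L \<Longrightarrow> x j \<le> 1"
    and R0: "0 \<le> R 0"
  shows "j \<le> L \<Longrightarrow> R j \<ge> (1 - (\<Sum>i<j. x i)) * R 0"
proof (induction j)
  case (Suc j)
  then have j: "j < L" by simp
  have "0 \<le> x j * (\<Sum>i<j. x i) * R 0"
    using x Suc.prems R0 by (intro mult_nonneg_nonneg sum_nonneg) auto
  then have "(1 - (\<Sum>i<Suc j. x i)) * R 0 \<le> (1 - x j) * ((1 - (\<Sum>i<j. x i)) * R 0)"
    by (simp add: algebra_simps)
  also have "\<dots> \<le> (1 - x j) * R j"
    using Suc x(2)[OF j] by (intro mult_left_mono) auto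
  finally show ?case using step[OF j] by linarith
qed simp

text \<open>
  At \<open>n = m L\<close> the factor \<open>1 - L / n\<close> is \<open>(m - 1) / m\<close>, so \<open>(m - 1) R (m L)\<close> is nondecreasing and
  \<open>R (m L)\<close> is bounded below by a multiple of \<open>1 / m\<close>.
\<close>

lemma not_summable_if_slow_block_decay:
  fixes R :: "nat \<Rightarrow> real"
  assumes L: "L > 0" and pos: "\<And>n. n \<ge> 1 \<Longrightarrow> R n > 0"
    and step: "\<And>n. n \<ge> N \<Longrightarrow> R (n + L) \<ge> (1 - real L / real n) * R n"
  shows "\<not> summable R"
proof
  assume "summable R"
  define f where "f m = (real m - 1) * R (m * L)" for m
  define M where "M = N + 2"
  have mono: "f M \<le> f m" if "m \<ge> M" for m
    using that
  proof (induction m rule: dec_induct)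
    case (step m)
    have m: "m \<ge> 2" using step.hyps by (simp add: M_def)
    have "m * 1 \<le> m * L" using L by (intro mult_le_mono) auto
    then have "N \<le> m * L" using step.hyps unfolding M_def by linarith
    from assms(3)[OF this] have "(1 - real L / real (m * L)) * R (m * L) \<le> R (Suc m * L)"
      by (simp add: add.commute)
    then have "real m * ((1 - real L / real (m * L)) * R (m * L)) \<le> real m * R (Suc m * L)"
      by (intro mult_left_mono) auto
    moreover have "real m * ((1 - real L / real (m * L)) * R (m * L)) = f m"
      using m L by (simp add: f_def field_simps)
    moreover have "f (Suc m) = real m * R (Suc m * L)" by (simp add: f_def)
    ultimately show ?case using step.IH by linarith
  qed simp
  have "f M > 0"
    unfolding f_def by (intro mult_pos_pos pos) (use L in \<open>auto simp: M_def\<close>)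
  have "summable (\<lambda>m. R (m * L))"
  proof -
    have "(\<lambda>m. \<Sum>i\<in>{m * L..<m * L + L}. R i) sums suminf R"
      using sums_group[OF summable_sums[OF \<open>summable R\<close>], of L] L by simp
    then have sm: "summable (\<lambda>m. \<Sum>i\<in>{m * L..<m * L + L}. R i)" by (rule sums_summable)
    show ?thesis
    proof (rule summable_comparison_test'[OF sm, of 1])
      fix m :: nat assume m: "m \<ge> 1"
      have pos': "R i > 0" if "i \<ge> m * L" for i
        using that m L by (intro pos) (metis One_nat_def Suc_leI le_trans mult_pos_pos less_le_trans zero_less_one)
      have "R (m * L) \<le> (\<Sum>i\<in>{m * L..<m * L + L}. R i)"
        by (rule member_le_sum) (use L pos' less_imp_le in auto)
      then show "norm (R (m * L)) \<le> (\<Sum>i\<in>{m * L..<m * L + L}. R i)"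
        using pos'[of "m * L"] by simp
    qed
  qed
  then have "summable (\<lambda>m. R (m * L) / f M)" by (rule summable_divide)
  then have "summable (\<lambda>m. 1 / real m)"
  proof (rule summable_comparison_test'[of _ M])
    fix m assume m: "m \<ge> M"
    have "f M \<le> real m * R (m * L)"
    proof -
      have "m * L \<ge> 1" using m L by (simp add: M_def Suc_le_eq)
      then show ?thesis using mono[OF m] pos[of "m * L"] by (simp add: f_def algebra_simps)
    qed
    then show "norm (1 / real m) \<le> R (m * L) / f M"
      using m \<open>f M > 0\<close> by (simp add: field_simps M_def)
  qed
  then show False using not_summable_harmonic[where 'a = real] by (simp add: inverse_eq_divide)
qed

text \<open>
  The strict inequality \<open>c B < 1\<close> leaves a margin that absorbs the drift of \<open>\<zeta>\<close> away from the exact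
  orbit: this drift is \<open>O(1/n)\<close> over a block, so it contributes only \<open>O(1/n\<^sup>2)\<close> to the relative loss.
\<close>

lemma perturbed_rotation_not_summable:
  fixes y :: "nat \<Rightarrow> complex" and g :: "nat \<Rightarrow> real" and k c B :: real
  assumes rec: "\<And>n. n \<ge> 1 \<Longrightarrow> y (Suc n) = cis (pi * k) * (y n - of_real (g n * Im (y n)))"
    and g: "\<And>n. n \<ge> N \<Longrightarrow> \<bar>g n\<bar> \<le> c / real n"
    and nz: "\<And>n. n \<ge> 1 \<Longrightarrow> y n \<noteq> 0"
    and L: "L > 0" and block: "\<And>x. (\<Sum>j<L. \<bar>sin (x + 2 * pi * of_nat j * k)\<bar>) \<le> real L * B"
    and c: "c \<ge> 0" and cB: "c * B < 1"
  shows "\<not> summable (\<lambda>n. (cmod (y n))\<^sup>2)"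
proof -
  \<comment> \<open>With \<open>y n = r e\<^sup>i\<^sup>\<phi>\<close>, the imaginary part of \<open>\<zeta> n\<close> is \<open>sin (2 \<phi>)\<close>, the quantity that governs
      the growth of the modulus.\<close>
  define \<zeta> where "\<zeta> n = (sgn (y n))\<^sup>2" for n
  define w where "w = cis (2 * pi * k)"
  have norm_\<zeta>: "norm (\<zeta> n) = 1" if "n \<ge> 1" for n
    using nz[OF that] by (simp add: \<zeta>_def norm_power norm_sgn)
  have drift: "norm (\<zeta> (Suc n) - w * \<zeta> n) \<le> 4 * c / real n" if n: "n \<ge> 1" "n \<ge> N" for n
  proof -
    define d where "d = complex_of_real (g n * Im (y n))"
    have "norm d \<le> c / real n * norm (y n)"
      unfolding d_def norm_of_real abs_mult using g[OF n(2)] abs_Im_le_cmod[of "y n"] c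
      by (intro mult_mono) auto
    then have d: "norm d / norm (y n) \<le> c / real n"
      using nz[OF n(1)] by (simp add: pos_divide_le_eq)
    have "sgn (y (Suc n)) = cis (pi * k) * sgn (y n - d)"
      unfolding rec[OF n(1)] d_def sgn_mult by (simp add: sgn_div_norm)
    then have "\<zeta> (Suc n) = w * (sgn (y n - d))\<^sup>2"
      by (simp add: \<zeta>_def w_def power_mult_distrib power2_eq_square cis_mult[symmetric] cis_mult mult_ac)
    then have "norm (\<zeta> (Suc n) - w * \<zeta> n) = norm (w * ((sgn (y n - d))\<^sup>2 - (sgn (y n))\<^sup>2))"
      by (simp add: \<zeta>_def algebra_simps)
    also have "\<dots> = norm ((sgn (y n - d))\<^sup>2 - (sgn (y n))\<^sup>2)"
      by (simp add: norm_mult w_def)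
    also have "\<dots> \<le> 2 * norm (sgn (y n - d) - sgn (y n))"
      using norm_power_diff[of "sgn (y n - d)" "sgn (y n)" 2] by (simp add: norm_sgn)
    also have "\<dots> \<le> 2 * (2 * norm d / norm (y n))"
      using norm_sgn_diff_le[OF nz[OF n(1)], of d] by simp
    also have "\<dots> \<le> 4 * c / real n" using d by simp
    finally show ?thesis .
  qed
  have drift_sum: "norm (\<zeta> (n + j) - w ^ j * \<zeta> n) \<le> real j * (4 * c / real n)" if n: "n \<ge> 1" "n \<ge> N" for n j
  proof (induction j)
    case (Suc j)
    have "\<zeta> (n + Suc j) - w ^ Suc j * \<zeta> n = (\<zeta> (Suc (n + j)) - w * \<zeta> (n + j)) + w * (\<zeta> (n + j) - w ^ j * \<zeta> n)"
      by (simp add: algebra_simps)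
    also have "norm \<dots> \<le> norm (\<zeta> (Suc (n + j)) - w * \<zeta> (n + j)) + norm (w * (\<zeta> (n + j) - w ^ j * \<zeta> n))"
      by (rule norm_triangle_ineq)
    also have "norm (w * (\<zeta> (n + j) - w ^ j * \<zeta> n)) = norm (\<zeta> (n + j) - w ^ j * \<zeta> n)"
      by (simp add: norm_mult w_def)
    also have "norm (\<zeta> (Suc (n + j)) - w * \<zeta> (n + j)) \<le> 4 * c / real n"
    proof -
      have "4 * c / real (n + j) \<le> 4 * c / real n" using n c by (intro divide_left_mono) auto
      then show ?thesis using drift[of "n + j"] n by simp
    qed
    finally show ?case using Suc by (simp only: of_nat_Suc distrib_right) simp
  qed simp
  \<comment> \<open>Each of the \<open>L\<close> terms of a block drifts by at most \<open>L (4 c / n)\<close>.\<close>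
  define D where "D = real L * real L * (4 * c)"
  have block_\<zeta>: "(\<Sum>j<L. \<bar>Im (\<zeta> (n + j))\<bar>) \<le> real L * B + D / real n" if n: "n \<ge> 1" "n \<ge> N" for n
  proof -
    have \<zeta>n: "\<zeta> n = cis (Arg (\<zeta> n))"
      using norm_\<zeta>[OF n(1)] rcis_cmod_Arg[of "\<zeta> n"] by (simp add: rcis_def)
    have "\<bar>Im (\<zeta> (n + j))\<bar> \<le> \<bar>sin (Arg (\<zeta> n) + 2 * pi * of_nat j * k)\<bar> + real L * (4 * c / real n)" if "j < L" for j
    proof -
      have "w ^ j * cis (Arg (\<zeta> n)) = cis (Arg (\<zeta> n) + 2 * pi * of_nat j * k)"
        unfolding w_def Complex.DeMoivre cis_mult by (rule arg_cong[where f = cis]) simp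
      then have "w ^ j * \<zeta> n = cis (Arg (\<zeta> n) + 2 * pi * of_nat j * k)"
        using \<zeta>n by simp
      then have "Im (w ^ j * \<zeta> n) = sin (Arg (\<zeta> n) + 2 * pi * of_nat j * k)" by simp
      moreover have "\<bar>Im (\<zeta> (n + j)) - Im (w ^ j * \<zeta> n)\<bar> \<le> real j * (4 * c / real n)"
        using abs_Im_le_cmod[of "\<zeta> (n + j) - w ^ j * \<zeta> n"] drift_sum[OF n, of j] by simp
      moreover have "real j * (4 * c / real n) \<le> real L * (4 * c / real n)"
        using that c by (intro mult_right_mono) auto
      ultimately show ?thesis by linarith
    qed
    then have "(\<Sum>j<L. \<bar>Im (\<zeta> (n + j))\<bar>)
        \<le> (\<Sum>j<L. \<bar>sin (Arg (\<zeta> n) + 2 * pi * of_nat j * k)\<bar> + real L * (4 * c / real n))"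
      by (intro sum_mono) auto
    also have "\<dots> \<le> real L * B + D / real n"
      using block[of "Arg (\<zeta> n)"] by (simp add: sum.distrib D_def)
    finally show ?thesis .
  qed
  define R where "R n = (cmod (y n))\<^sup>2" for n
  have R_pos: "R n > 0" if "n \<ge> 1" for n using nz[OF that] by (simp add: R_def)
  have R_step: "R (Suc n) \<ge> (1 - c / real n * \<bar>Im (\<zeta> n)\<bar>) * R n" if n: "n \<ge> 1" "n \<ge> N" for n
  proof -
    have "R (Suc n) = (cmod (y n - of_real (g n * Im (y n))))\<^sup>2"
      by (simp add: R_def rec[OF n(1)] norm_mult)
    also have "\<dots> = R n - g n * (2 * Re (y n) * Im (y n)) + (g n * Im (y n))\<^sup>2"
      unfolding R_def cmod_power2 by (simp add: power2_eq_square algebra_simps)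
    also have "2 * Re (y n) * Im (y n) = Im (\<zeta> n) * R n"
    proof -
      have "\<zeta> n * of_real (R n) = (sgn (y n) * of_real (norm (y n)))\<^sup>2"
        by (simp add: \<zeta>_def R_def power_mult_distrib)
      also have "sgn (y n) * of_real (norm (y n)) = y n"
        using nz[OF n(1)] by (simp add: sgn_div_norm scaleR_conv_of_real)
      finally have "Im (\<zeta> n * of_real (R n)) = Im ((y n)\<^sup>2)" by simp
      then show ?thesis by (simp add: power2_eq_square)
    qed
    finally have "R (Suc n) \<ge> R n - g n * (Im (\<zeta> n) * R n)" by simp
    moreover have "g n * (Im (\<zeta> n) * R n) \<le> c / real n * (\<bar>Im (\<zeta> n)\<bar> * R n)"
    proof -
      have "g n * (Im (\<zeta> n) * R n) \<le> \<bar>g n\<bar> * (\<bar>Im (\<zeta> n)\<bar> * R n)"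
        using R_pos[OF n(1)] abs_ge_self[of "g n * (Im (\<zeta> n) * R n)"] by (simp add: abs_mult)
      also have "\<dots> \<le> c / real n * (\<bar>Im (\<zeta> n)\<bar> * R n)"
        using g[OF n(2)] R_pos[OF n(1)] by (intro mult_right_mono) auto
      finally show ?thesis .
    qed
    ultimately show ?thesis by (simp add: algebra_simps)
  qed
  \<comment> \<open>\<open>M \<ge> c\<close> keeps every single-step loss at most 1; the second bound on \<open>M\<close> makes the drift term
      \<open>c D / n\<close> fit into the margin \<open>L (1 - c B)\<close>.\<close>
  obtain M :: nat where M: "real M \<ge> c" "real M \<ge> c * D / (real L * (1 - c * B))" "M \<ge> N" "M \<ge> 1"
  proof -
    obtain M0 :: nat where "real M0 \<ge> max c (c * D / (real L * (1 - c * B)))"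
      using real_arch_simple by blast
    then show thesis by (intro that[of "M0 + N + 1"]) auto
  qed
  have "R (n + L) \<ge> (1 - real L / real n) * R n" if "n \<ge> M" for n
  proof -
    from that M have n: "n \<ge> 1" "n \<ge> N" "real n \<ge> c" "real n \<ge> c * D / (real L * (1 - c * B))" by linarith+
    define x where "x j = c / real (n + j) * \<bar>Im (\<zeta> (n + j))\<bar>" for j
    have x0: "0 \<le> x j" and x1: "x j \<le> 1" for j
    proof -
      show "0 \<le> x j" using c by (simp add: x_def)
      have "x j \<le> 1 * 1" unfolding x_def
        using abs_Im_le_cmod[of "\<zeta> (n + j)"] norm_\<zeta>[of "n + j"] n c by (intro mult_mono) auto
      then show "x j \<le> 1" by simp
    qed
    have "R (n + L) \<ge> (1 - (\<Sum>j<L. x j)) * R (n + 0)"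
    proof (rule one_minus_sum_lower_bound[where R = "\<lambda>j. R (n + j)" and L = L])
      show "R (n + Suc j) \<ge> (1 - x j) * R (n + j)" for j
        using R_step[of "n + j"] n by (simp add: x_def)
    qed (use x0 x1 R_pos[OF n(1)] in auto)
    moreover have "(\<Sum>j<L. x j) \<le> real L / real n"
    proof -
      have "(\<Sum>j<L. x j) \<le> (\<Sum>j<L. c / real n * \<bar>Im (\<zeta> (n + j))\<bar>)"
        unfolding x_def using n c by (intro sum_mono mult_right_mono divide_left_mono) auto
      also have "\<dots> \<le> c / real n * (real L * B + D / real n)"
        unfolding sum_distrib_left[symmetric] using block_\<zeta>[OF n(1,2)] c by (intro mult_left_mono) auto
      also have "\<dots> = (c * B * real L + c * D / real n) / real n"
        by (simp add: add_divide_distrib algebra_simps)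
      also have "\<dots> \<le> real L / real n"
      proof (intro divide_right_mono)
        have "c * D \<le> real n * (real L * (1 - c * B))"
          using n(4) L cB by (simp add: divide_le_eq)
        then have "c * D / real n \<le> real L * (1 - c * B)"
          using n(1) by (simp add: divide_le_eq mult.commute)
        then show "c * B * real L + c * D / real n \<le> real L" by (simp add: algebra_simps)
      qed simp
      finally show ?thesis .
    qed
    then have "(1 - real L / real n) * R n \<le> (1 - (\<Sum>j<L. x j)) * R n"
      using R_pos[OF n(1)] by (intro mult_right_mono) auto
    ultimately show ?thesis by simp
  qed
  then have "\<not> summable R"
    by (intro not_summable_if_slow_block_decay[OF L R_pos]) auto
  then show ?thesis by (simp add: R_def[abs_def])
qed


section \<open>Absence of eigenvalues\<close>

text \<open>
  The variable \<open>y n = e\<^sup>i\<^sup>\<pi>\<^sup>k v n - v (n - 1)\<close> diagonalises the free recursion on real solutions: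
  without potential it is multiplied by \<open>e\<^sup>i\<^sup>\<pi>\<^sup>k\<close> in each step. Its imaginary part recovers \<open>v n\<close>, so the
  perturbation is again a function of \<open>y n\<close>. A zero of \<open>y\<close> would be two consecutive zeros of \<open>v\<close>, which
  propagate in both directions and make \<open>v\<close> trivial.
\<close>

lemma real_solution_not_square_summable:
  fixes v V :: "nat \<Rightarrow> real" and k b B :: real
  assumes rec: "\<And>n. n \<ge> 1 \<Longrightarrow> v (n + 1) + v (n - 1) + V n * v n = 2 * cos (pi * k) * v n"
    and nontrivial: "v m \<noteq> 0"
    and s: "sin (pi * k) > 0"
    and V: "\<And>n. n \<ge> N \<Longrightarrow> \<bar>V n\<bar> \<le> b / real n"
    and L: "L > 0" and block: "\<And>x. (\<Sum>j<L. \<bar>sin (x + 2 * pi * of_nat j * k)\<bar>) \<le> real L * B"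
    and b: "b \<ge> 0" and bB: "b * B < sin (pi * k)"
  shows "\<not> summable (\<lambda>n. (v n)\<^sup>2)"
proof
  assume sm: "summable (\<lambda>n. (v n)\<^sup>2)"
  define y where "y n = cis (pi * k) * of_real (v n) - of_real (v (n - 1))" for n
  define g where "g n = V n / sin (pi * k)" for n
  have Im_y: "Im (y n) = sin (pi * k) * v n" for n by (simp add: y_def)
  have y_rec: "y (Suc n) = cis (pi * k) * (y n - of_real (g n * Im (y n)))" if n: "n \<ge> 1" for n
  proof -
    have gy: "g n * Im (y n) = V n * v n" using s by (simp add: g_def Im_y)
    have v: "v (Suc n) = 2 * cos (pi * k) * v n - V n * v n - v (n - 1)" using rec[OF n] by simp
    have "complex_of_real (2 * cos (pi * k)) = cis (pi * k) + cis (- (pi * k))"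
      by (simp add: complex_eq_iff)
    moreover have "cis (pi * k) * cis (- (pi * k)) = 1" by (simp add: cis_mult)
    ultimately have "cis (pi * k) * of_real (2 * cos (pi * k)) = (cis (pi * k))\<^sup>2 + 1"
      by (simp add: power2_eq_square distrib_left)
    then have c: "cis (pi * k) * of_real (2 * cos (pi * k)) * of_real (v n) = ((cis (pi * k))\<^sup>2 + 1) * of_real (v n)"
      by simp
    have "y (Suc n) = cis (pi * k) * of_real (2 * cos (pi * k)) * of_real (v n)
        - cis (pi * k) * of_real (V n * v n) - cis (pi * k) * of_real (v (n - 1)) - of_real (v n)"
      unfolding y_def v by (simp add: algebra_simps)
    then show ?thesis
      unfolding c gy by (simp add: y_def power2_eq_square algebra_simps)
  qed
  have zero: "v n = 0 \<and> v (n - 1) = 0" if "y n = 0" for n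
    using that Im_y[of n] s by (simp add: y_def)
  have nz: "y n \<noteq> 0" if n: "n \<ge> 1" for n
  proof
    assume y0: "y n = 0"
    have up: "y i = 0" if "i \<ge> n" for i
      using that
    proof (induction i rule: dec_induct)
      case (step i) then show ?case using y_rec[of i] n by simp
    qed (use y0 in simp)
    have down: "y i = 0" if "i \<le> n" "i \<ge> 1" for i
      using that
    proof (induction i rule: inc_induct)
      case (step i)
      then have "v (Suc i) = 0" "v i = 0" using zero[of "Suc i"] by auto
      then show ?case using rec[of i] step.prems by (simp add: y_def)
    qed (use y0 in simp)
    have "y i = 0" if "i \<ge> 1" for i using up[of i] down[of i] that by linarith
    then have "v m = 0" using zero[of m] zero[of "Suc m"] by simp
    then show False using nontrivial by simp
  qed
  have "\<not> summable (\<lambda>n. (cmod (y n))\<^sup>2)"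
  proof (rule perturbed_rotation_not_summable[where y = y and g = g and k = k and N = N and L = L and B = B
        and c = "b / sin (pi * k)"])
    show "y (Suc n) = cis (pi * k) * (y n - of_real (g n * Im (y n)))" if "n \<ge> 1" for n
      by (rule y_rec[OF that])
    show "\<bar>g n\<bar> \<le> b / sin (pi * k) / real n" if "n \<ge> N" for n
      using divide_right_mono[OF V[OF that], of "sin (pi * k)"] s by (simp add: g_def abs_div mult.commute)
    show "b / sin (pi * k) \<ge> 0" using b s by simp
    show "b / sin (pi * k) * B < 1" using bB s by (simp add: field_simps)
  qed (use nz L block in auto)
  moreover have "summable (\<lambda>n. (cmod (y n))\<^sup>2)"
  proof (rule summable_comparison_test'[of "\<lambda>n. 2 * (v n)\<^sup>2 + 2 * (v (n - 1))\<^sup>2" 0])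
    have "summable (\<lambda>n. (v (n - 1))\<^sup>2)"
      using sm summable_Suc_iff[of "\<lambda>n. (v (n - 1))\<^sup>2"] by simp
    with sm show "summable (\<lambda>n. 2 * (v n)\<^sup>2 + 2 * (v (n - 1))\<^sup>2)"
      by (intro summable_add summable_mult)
    fix n
    have "cmod (y n) \<le> \<bar>v n\<bar> + \<bar>v (n - 1)\<bar>"
      unfolding y_def by (rule norm_triangle_le_diff) (simp add: norm_mult)
    then have "(cmod (y n))\<^sup>2 \<le> (\<bar>v n\<bar> + \<bar>v (n - 1)\<bar>)\<^sup>2" by (rule power_mono) simp
    also have "\<dots> \<le> 2 * (v n)\<^sup>2 + 2 * (v (n - 1))\<^sup>2"
      using sum_squares_bound[of "\<bar>v n\<bar>" "\<bar>v (n - 1)\<bar>"] by (simp add: power2_sum)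
    finally show "norm ((cmod (y n))\<^sup>2) \<le> 2 * (v n)\<^sup>2 + 2 * (v (n - 1))\<^sup>2" by simp
  qed
  ultimately show False by simp
qed

theorem theorem2p1:
  fixes q :: nat and V :: "nat \<Rightarrow> real" and a \<theta> :: real
  assumes q: "q = 0 \<or> q \<ge> 2"
    and limsup_V: "limsup (\<lambda>n. ereal \<bar>real n * V n\<bar>) = ereal a"
    and a_less: "a < 1 / A q"
    and \<theta>: "\<theta> \<in> {0..pi}"
  defines "E_q \<equiv> 2 * sqrt (1 - a\<^sup>2 * (A q)\<^sup>2)"
  shows "\<not> (\<exists>E \<in> {- E_q<..<E_q} \<inter> S q. is_eigenvalue V \<theta> E)"
proof
  assume "\<exists>E \<in> {- E_q<..<E_q} \<inter> S q. is_eigenvalue V \<theta> E"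
  then obtain E u m where E: "- E_q < E" "E < E_q" "E \<in> S q" and m: "u m \<noteq> 0"
    and u: "\<And>n. n \<ge> 1 \<Longrightarrow> schroedinger V u n = of_real E * u n"
    and u_l2: "(\<lambda>n. (cmod (u n))\<^sup>2) summable_on {1..}"
    unfolding is_eigenvalue_def by auto
  define k where "k = quasimomentum E"
  have "E \<in> {-2<..<2}" using E(3) by (auto simp: S_def split: if_splits)
  note k = quasimomentum_properties[OF this, folded k_def]
  have s: "sin (pi * k) > 0" using k by (intro sin_gt_zero) auto
  have Aq: "A q > 0" using A_pos[OF q] .
  have a0: "a \<ge> 0"
  proof -
    have "ereal 0 \<le> limsup (\<lambda>n. ereal \<bar>real n * V n\<bar>)" by (intro le_Limsup) auto
    then show ?thesis unfolding limsup_V by simp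
  qed
  \<comment> \<open>The energy window says \<open>cos\<^sup>2 (pi k) < 1 - a\<^sup>2 A\<^sub>q\<^sup>2\<close>.\<close>
  have "a * A q < sin (pi * k)"
  proof -
    have "a * A q < 1" using a_less Aq by (simp add: pos_less_divide_eq)
    then have "(a * A q)\<^sup>2 < 1" using a0 Aq by (simp add: abs_square_less_1)
    then have "(E / 2)\<^sup>2 < (sqrt (1 - a\<^sup>2 * (A q)\<^sup>2))\<^sup>2"
      using E(1,2) unfolding E_q_def by (subst power2_abs[symmetric], intro power_strict_mono) auto
    then have "(cos (pi * k))\<^sup>2 < 1 - (a * A q)\<^sup>2"
      using \<open>(a * A q)\<^sup>2 < 1\<close> k(3) by (simp add: power_mult_distrib)
    then have "(a * A q)\<^sup>2 < (sin (pi * k))\<^sup>2"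
      using sin_cos_squared_add[of "pi * k"] by linarith
    then show ?thesis using less_imp_le[OF s] by (rule power2_less_imp_less)
  qed
  then obtain \<epsilon> where \<epsilon>: "\<epsilon> > 0" "(a + \<epsilon>) * (A q + \<epsilon>) < sin (pi * k)"
  proof -
    have "((\<lambda>\<epsilon>. (a + \<epsilon>) * (A q + \<epsilon>)) \<longlongrightarrow> (a + 0) * (A q + 0)) (at_right 0)"
      by (intro tendsto_intros)
    then have "\<forall>\<^sub>F \<epsilon> in at_right 0. (a + \<epsilon>) * (A q + \<epsilon>) < sin (pi * k)"
      by (rule order_tendstoD) (use \<open>a * A q < sin (pi * k)\<close> in simp)
    with eventually_at_right_less[of 0] have "\<forall>\<^sub>F \<epsilon> in at_right 0. 0 < \<epsilon> \<and> (a + \<epsilon>) * (A q + \<epsilon>) < sin (pi * k)"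
      by eventually_elim simp
    then show thesis using that eventually_happens'[OF trivial_limit_at_right_real] by blast
  qed
  obtain N where N: "\<And>n. n \<ge> N \<Longrightarrow> \<bar>real n * V n\<bar> < a + \<epsilon>"
  proof -
    have "\<forall>\<^sub>F n in sequentially. ereal \<bar>real n * V n\<bar> < ereal (a + \<epsilon>)"
      by (rule Limsup_lessD) (use limsup_V \<epsilon>(1) in simp)
    then show thesis using that by (auto simp: eventually_sequentially)
  qed
  have V: "\<bar>V n\<bar> \<le> (a + \<epsilon>) / real n" if "n \<ge> Suc N" for n
    using N[of n] that by (simp add: abs_mult field_simps)
  obtain L where L: "L > 0" "\<And>x. (\<Sum>j<L. \<bar>sin (x + 2 * pi * of_nat j * k)\<bar>) \<le> real L * (A q + \<epsilon>)"
    using sum_abs_sin_rotation_le[OF q E(3) \<epsilon>(1)] unfolding k_def by blast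
  have u_summable: "summable (\<lambda>n. (cmod (u n))\<^sup>2)"
  proof -
    have "{0::nat..} = insert 0 {1..}" by auto
    then have "(\<lambda>n. (cmod (u n))\<^sup>2) summable_on UNIV"
      using u_l2 summable_on_Un_disjoint[of "\<lambda>n. (cmod (u n))\<^sup>2" "{0}" "{1..}"] by simp
    then show ?thesis by (rule summable_on_UNIV_nonneg_real_iff[THEN iffD1, rotated]) simp
  qed
  \<comment> \<open>The equation is real, so real and imaginary parts of \<open>u\<close> solve it, and one of them is nontrivial.\<close>
  have no_solution: "\<not> summable (\<lambda>n. (v n)\<^sup>2)"
    if "\<And>n. n \<ge> 1 \<Longrightarrow> v (n + 1) + v (n - 1) + V n * v n = E * v n" "v m \<noteq> 0" for v
    by (rule real_solution_not_square_summable[where V = V and k = k and b = "a + \<epsilon>" and N = "Suc N"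
          and L = L and B = "A q + \<epsilon>" and m = m])
       (use that s V L k(3) \<epsilon> a0 in auto)
  have "\<not> summable (\<lambda>n. (Re (u n))\<^sup>2)" if "Re (u m) \<noteq> 0"
    using arg_cong[OF u, of _ Re] that by (intro no_solution) (simp_all add: schroedinger_def)
  moreover have "\<not> summable (\<lambda>n. (Im (u n))\<^sup>2)" if "Im (u m) \<noteq> 0"
    using arg_cong[OF u, of _ Im] that by (intro no_solution) (simp_all add: schroedinger_def)
  moreover have "summable (\<lambda>n. (Re (u n))\<^sup>2)" "summable (\<lambda>n. (Im (u n))\<^sup>2)"
    by (rule summable_comparison_test'[OF u_summable, of 0]; simp add: cmod_power2)+
  ultimately show False using m by (auto simp: complex_eq_iff)
qed

end
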